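(* For each $g\in\Sigma$, the graded $\mathcal{R}$-submodule $\mathfrak{I}_{[g]}=\mathfrak{I}_{\mathbf{0},[g]}\oplus V_{[g]}$ associated with the equivalence class $[g]$ is a graded ideal of $(\mathcal{M}_I(\mathcal{R}),\star,\psi,\phi)$.
   Context: $\mathbb{N}$ is the set of non-negative integers. For subsets $X,Y$ of an algebra with product $\star$, $X\star Y$ denotes the submodule spanned by all $x\star y$, $x\in X$, $y\in Y$. Setting. Let $\mathcal{R}$ be a commutative ring, $I$ an arbitrary index set, and $\mathcal{M}_I(\mathcal{R})$ the $\mathcal{R}$-algebra of $I\times I$ matrices over $\mathcal{R}$ with only finitely many non-zero entries, with the usual product (juxtaposition). Let $\psi,\phi$ be two commuting $\mathcal{R}$-algebra automorphisms of it and put $x\star y:=\psi(x)\phi(y)$. Let $(G,+)$ be an abelian group with neutral element $\mathbf{0}$ and let $\alpha,\beta$ be two commuting automorphisms of $G$. Suppose $\mathcal{M}_I(\mathcal{R})=\bigoplus_{g\in G}\mathcal{M}_I(\mathcal{R})_g$ is a direct sum of $\mathcal{R}$-submodules such that, for all $g,g'\in G$, $\psi(\mathcal{M}_I(\mathcal{R})_g)\subseteq\mathcal{M}_I(\mathcal{R})_{\alpha(g)}$, $\phi(\mathcal{M}_I(\mathcal{R})_g)\subseteq\mathcal{M}_I(\mathcal{R})_{\beta(g)}$ and $\mathcal{M}_I(\mathcal{R})_g\star\mathcal{M}_I(\mathcal{R})_{g'}\subseteq\mathcal{M}_I(\mathcal{R})_{\alpha(g)+\beta(g')}$. The support is $\Sigma:=\{g\in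 G\setminus\{\mathbf{0}\}\mid \mathcal{M}_I(\mathcal{R})_g\neq 0\}$. It is assumed symmetric: $g\in\Sigma$ implies $-g\in\Sigma$. Connections. For $g,g'\in\Sigma$, a connection from $g$ to $g'$ is a finite sequence $g_1,\dots,g_k$ of elements of $\Sigma$ ($k\ge 1$) such that: if $k=1$, then $g_1\in\{\alpha^i\circ\beta^j(g)\mid i,j\in\mathbb{N}\}\cap\{\pm\alpha^m\circ\beta^n(g')\mid m,n\in\mathbb{N}\}$; if $k\ge 2$, then (1) $g_1\in\{\alpha^i\circ\beta^j(g)\mid i,j\in\mathbb{N}\}$, (2) for every $2\le l\le k-1$ the element $\alpha^{l-1}(g_1)+\sum_{t=2}^{l}\alpha^{l-t}\circ\beta(g_t)$ belongs to $\Sigma$, and (3) $\alpha^{k-1}(g_1)+\sum_{t=2}^{k}\alpha^{k-t}\circ\beta(g_t)\in\{\pm\alpha^m\circ\beta^n(g')\mid m,n\in\mathbb{N}\}$. Write $g\sim g'$ if a connection from $g$ to $g'$ exists; $\sim$ is an equivalence relation on $\Sigma$ and $[g]$ denotes the class of $g$. For $g\in\Sigma$ put $\mathfrak{I}_{\mathbf{0},[g]}:=\operatorname{Span}_{\mathcal{R}}\{\mathcal{M}_I(\mathcal{R})_{\beta(g')}\star\mathcal{M}_I(\mathcal{R})_{-\alpha(g')}\mid g'\in[g]\}\subseteq\mathcal{M}_I(\mathcal{R})_{\mathbf{0}}$, $V_{[g]}:=\bigoplus_{g'\in[g]}\mathcal{M}_I(\mathcal{R})_{g'}$ and $\mathfrak{I}_{[g]}:=\mathfrak{I}_{\mathbf{0},[g]}\oplus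 V_{[g]}$. A graded ideal of $(\mathcal{M}_I(\mathcal{R}),\star,\psi,\phi)$ is an $\mathcal{R}$-submodule $\mathfrak{I}$ with $\mathfrak{I}\star\mathcal{M}_I(\mathcal{R})+\mathcal{M}_I(\mathcal{R})\star\mathfrak{I}\subseteq\mathfrak{I}$, $\psi(\mathfrak{I})=\mathfrak{I}$, $\phi(\mathfrak{I})=\mathfrak{I}$, and $\mathfrak{I}=\bigoplus_{g\in G}(\mathfrak{I}\cap\mathcal{M}_I(\mathcal{R})_g)$. *)

theory Defs
  imports
    "HOL.Modules"
    "HOL-Library.Function_Algebras"
    "HOL-Library.Set_Algebras"
    "HOL-Library.Groups_Big_Fun"
begin

type_synonym ('i, 'r) imatrix = "'i \<Rightarrow> 'i \<Rightarrow> 'r"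

definition fin_matrices :: "'i set \<Rightarrow> ('i, 'r::comm_ring_1) imatrix set" where
  "fin_matrices I = {A. finite {(i, j). A i j \<noteq> 0} \<and> {(i, j). A i j \<noteq> 0} \<subseteq> I \<times> I}"

text \<open>Addition and zero of matrices are the pointwise ones of the function type. The sum
  over \<open>k\<close> below is the sum over those \<open>k\<close> whose summand is non-zero; there are finitely many
  of them when the factors lie in \<^const>\<open>fin_matrices\<close>.\<close>

definition mmult :: "('i, 'r::comm_ring_1) imatrix \<Rightarrow> ('i, 'r) imatrix \<Rightarrow> ('i, 'r) imatrix" where
  "mmult A B = (\<lambda>i j. \<Sum>k. A i k * B k j)"

definition mscale :: "'r::comm_ring_1 \<Rightarrow> ('i, 'r) imatrix \<Rightarrow> ('i, 'r) imatrix" where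
  "mscale r A = (\<lambda>i j. r * A i j)"

text \<open>Submodules and spans are taken in the module of all functions; a subset of
  \<^term>\<open>fin_matrices I\<close> has the same span there as in \<^term>\<open>fin_matrices I\<close>.\<close>

interpretation imat: module "mscale :: 'r::comm_ring_1 \<Rightarrow> ('i, 'r) imatrix \<Rightarrow> ('i, 'r) imatrix"
  by unfold_locales (auto simp: mscale_def fun_eq_iff algebra_simps)

definition algebra_automorphism ::
    "'i set \<Rightarrow> (('i, 'r::comm_ring_1) imatrix \<Rightarrow> ('i, 'r) imatrix) \<Rightarrow> bool" where
  "algebra_automorphism I f \<longleftrightarrow>
     bij_betw f (fin_matrices I) (fin_matrices I) \<and>
     (\<forall>A\<in>fin_matrices I. \<forall>B\<in>fin_matrices I. f (A + B) = f A + f B) \<and>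
     (\<forall>r. \<forall>A\<in>fin_matrices I. f (mscale r A) = mscale r (f A)) \<and>
     (\<forall>A\<in>fin_matrices I. \<forall>B\<in>fin_matrices I. f (mmult A B) = mmult (f A) (f B))"

definition group_automorphism :: "('g::ab_group_add \<Rightarrow> 'g) \<Rightarrow> bool" where
  "group_automorphism a \<longleftrightarrow> bij a \<and> (\<forall>g h. a (g + h) = a g + a h)"

definition star ::
    "(('i, 'r::comm_ring_1) imatrix \<Rightarrow> ('i, 'r) imatrix) \<Rightarrow> (('i, 'r) imatrix \<Rightarrow> ('i, 'r) imatrix)
      \<Rightarrow> ('i, 'r) imatrix \<Rightarrow> ('i, 'r) imatrix \<Rightarrow> ('i, 'r) imatrix" where
  "star \<psi> \<phi> x y = mmult (\<psi> x) (\<phi> y)"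

definition star_set ::
    "(('i, 'r::comm_ring_1) imatrix \<Rightarrow> ('i, 'r) imatrix) \<Rightarrow> (('i, 'r) imatrix \<Rightarrow> ('i, 'r) imatrix)
      \<Rightarrow> ('i, 'r) imatrix set \<Rightarrow> ('i, 'r) imatrix set \<Rightarrow> ('i, 'r) imatrix set" where
  "star_set \<psi> \<phi> X Y = imat.span {star \<psi> \<phi> x y | x y. x \<in> X \<and> y \<in> Y}"

text \<open>\<open>W\<close> is the internal direct sum of the submodules \<open>V g\<close>, \<open>g \<in> S\<close>.\<close>

definition internal_direct_sum ::
    "'g set \<Rightarrow> ('g \<Rightarrow> ('i, 'r::comm_ring_1) imatrix set) \<Rightarrow> ('i, 'r) imatrix set \<Rightarrow> bool" where
  "internal_direct_sum S V W \<longleftrightarrow>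
     imat.subspace W \<and>
     (\<forall>g\<in>S. imat.subspace (V g) \<and> V g \<subseteq> W) \<and>
     (\<forall>x\<in>W. \<exists>!c. (\<forall>g\<in>S. c g \<in> V g) \<and> (\<forall>g. g \<notin> S \<longrightarrow> c g = 0) \<and>
                 finite {g. c g \<noteq> 0} \<and> x = (\<Sum>g. c g))"

definition support :: "('g::ab_group_add \<Rightarrow> ('i, 'r::comm_ring_1) imatrix set) \<Rightarrow> 'g set" where
  "support M = {g. g \<noteq> 0 \<and> M g \<noteq> {0}}"

definition orbit2 :: "('g \<Rightarrow> 'g) \<Rightarrow> ('g \<Rightarrow> 'g) \<Rightarrow> 'g \<Rightarrow> 'g set" where
  "orbit2 \<alpha> \<beta> g = {(\<alpha> ^^ i) ((\<beta> ^^ j) g) | i j. True}"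

definition signed_orbit2 ::
    "('g::ab_group_add \<Rightarrow> 'g) \<Rightarrow> ('g \<Rightarrow> 'g) \<Rightarrow> 'g \<Rightarrow> 'g set" where
  "signed_orbit2 \<alpha> \<beta> g = orbit2 \<alpha> \<beta> g \<union> uminus ` orbit2 \<alpha> \<beta> g"

text \<open>The term \<open>g\<^sub>t\<close> of a sequence \<open>g\<^sub>1, \<dots>, g\<^sub>k\<close> is the list entry \<open>gs ! (t - 1)\<close>.\<close>

definition conn_sum ::
    "('g::ab_group_add \<Rightarrow> 'g) \<Rightarrow> ('g \<Rightarrow> 'g) \<Rightarrow> 'g list \<Rightarrow> nat \<Rightarrow> 'g" where
  "conn_sum \<alpha> \<beta> gs l =
     (\<alpha> ^^ (l - 1)) (gs ! 0) + (\<Sum>t = 2..l. (\<alpha> ^^ (l - t)) (\<beta> (gs ! (t - 1))))"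

definition is_connection ::
    "('g::ab_group_add \<Rightarrow> 'g) \<Rightarrow> ('g \<Rightarrow> 'g) \<Rightarrow> 'g set \<Rightarrow> 'g \<Rightarrow> 'g \<Rightarrow> 'g list \<Rightarrow> bool" where
  "is_connection \<alpha> \<beta> S g g' gs \<longleftrightarrow>
     length gs \<ge> 1 \<and> set gs \<subseteq> S \<and>
     (length gs = 1 \<longrightarrow> gs ! 0 \<in> orbit2 \<alpha> \<beta> g \<inter> signed_orbit2 \<alpha> \<beta> g') \<and>
     (length gs \<ge> 2 \<longrightarrow>
        gs ! 0 \<in> orbit2 \<alpha> \<beta> g \<and>
        (\<forall>l. 2 \<le> l \<and> l \<le> length gs - 1 \<longrightarrow> conn_sum \<alpha> \<beta> gs l \<in> S) \<and>
        conn_sum \<alpha> \<beta> gs (length gs) \<in> signed_orbit2 \<alpha> \<beta> g')"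

definition conn_rel ::
    "('g::ab_group_add \<Rightarrow> 'g) \<Rightarrow> ('g \<Rightarrow> 'g) \<Rightarrow> 'g set \<Rightarrow> ('g \<times> 'g) set" where
  "conn_rel \<alpha> \<beta> S = {(g, g'). g \<in> S \<and> g' \<in> S \<and> (\<exists>gs. is_connection \<alpha> \<beta> S g g' gs)}"

definition conn_class ::
    "('g::ab_group_add \<Rightarrow> 'g) \<Rightarrow> ('g \<Rightarrow> 'g) \<Rightarrow> ('g \<Rightarrow> ('i, 'r::comm_ring_1) imatrix set)
      \<Rightarrow> 'g \<Rightarrow> 'g set" where
  "conn_class \<alpha> \<beta> M g = conn_rel \<alpha> \<beta> (support M) `` {g}"

definition ideal_zero_part ::
    "(('i, 'r::comm_ring_1) imatrix \<Rightarrow> ('i, 'r) imatrix) \<Rightarrow> (('i, 'r) imatrix \<Rightarrow> ('i, 'r) imatrix)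
      \<Rightarrow> ('g::ab_group_add \<Rightarrow> 'g) \<Rightarrow> ('g \<Rightarrow> 'g) \<Rightarrow> ('g \<Rightarrow> ('i, 'r) imatrix set) \<Rightarrow> 'g
      \<Rightarrow> ('i, 'r) imatrix set" where
  "ideal_zero_part \<psi> \<phi> \<alpha> \<beta> M g =
     imat.span (\<Union>g'\<in>conn_class \<alpha> \<beta> M g. star_set \<psi> \<phi> (M (\<beta> g')) (M (- \<alpha> g')))"

text \<open>The next two definitions form the sums; that the sums are direct is asserted separately.\<close>

definition class_part ::
    "('g::ab_group_add \<Rightarrow> 'g) \<Rightarrow> ('g \<Rightarrow> 'g) \<Rightarrow> ('g \<Rightarrow> ('i, 'r::comm_ring_1) imatrix set) \<Rightarrow> 'g
      \<Rightarrow> ('i, 'r) imatrix set" where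
  "class_part \<alpha> \<beta> M g = imat.span (\<Union>g'\<in>conn_class \<alpha> \<beta> M g. M g')"

definition class_ideal ::
    "(('i, 'r::comm_ring_1) imatrix \<Rightarrow> ('i, 'r) imatrix) \<Rightarrow> (('i, 'r) imatrix \<Rightarrow> ('i, 'r) imatrix)
      \<Rightarrow> ('g::ab_group_add \<Rightarrow> 'g) \<Rightarrow> ('g \<Rightarrow> 'g) \<Rightarrow> ('g \<Rightarrow> ('i, 'r) imatrix set) \<Rightarrow> 'g
      \<Rightarrow> ('i, 'r) imatrix set" where
  "class_ideal \<psi> \<phi> \<alpha> \<beta> M g = ideal_zero_part \<psi> \<phi> \<alpha> \<beta> M g + class_part \<alpha> \<beta> M g"

text \<open>In the third conjunct and in \<^const>\<open>class_ideal\<close>, \<open>+\<close> is the sum of submodules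
  (elementwise sum of sets).\<close>

definition graded_ideal ::
    "'i set \<Rightarrow> (('i, 'r::comm_ring_1) imatrix \<Rightarrow> ('i, 'r) imatrix)
      \<Rightarrow> (('i, 'r) imatrix \<Rightarrow> ('i, 'r) imatrix) \<Rightarrow> ('g \<Rightarrow> ('i, 'r) imatrix set)
      \<Rightarrow> ('i, 'r) imatrix set \<Rightarrow> bool" where
  "graded_ideal I \<psi> \<phi> M J \<longleftrightarrow>
     imat.subspace J \<and> J \<subseteq> fin_matrices I \<and>
     star_set \<psi> \<phi> J (fin_matrices I) + star_set \<psi> \<phi> (fin_matrices I) J \<subseteq> J \<and>
     \<psi> ` J = J \<and> \<phi> ` J = J \<and>
     internal_direct_sum UNIV (\<lambda>g. J \<inter> M g) J"

end

theory Submission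
  imports Defs
begin

text \<open>Write \<open>M\<^sub>h\<close> for the component of degree \<open>h\<close>. Since \<open>\<psi>\<close> is bijective and the sum of the components
  is direct, \<open>\<psi>(M\<^sub>h)\<close> is all of \<open>M\<^bsub>\<alpha>(h)\<^esub>\<close>, and likewise for \<open>\<phi>\<close> and \<open>\<beta>\<close>
  (\<open>automorphism_image_component\<close>). This removes the twist from the problem: the condition on
  \<open>\<star>\<close> says that the ordinary product maps \<open>M\<^sub>h \<times> M\<^sub>k\<close> into \<open>M\<^bsub>h+k\<^esub>\<close>, the support is mapped onto itself
  by \<open>\<alpha>\<close> and \<open>\<beta>\<close>, and \<open>M\<^bsub>\<beta>(h)\<^esub> \<star> M\<^bsub>-\<alpha>(h)\<^esub>\<close> is the span of the ordinary products of \<open>M\<^sub>a\<close> and \<open>M\<^bsub>-a\<^esub>\<close>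
  for \<open>a = \<alpha>(\<beta>(h))\<close>. A submodule that \<open>\<psi>\<close> and \<open>\<phi>\<close> map onto itself is an ideal for \<open>\<star>\<close> as soon as it
  is an ideal for the ordinary product.

  A class \<open>C\<close> of connected degrees is closed under negation, and \<open>a + b\<close> lies in \<open>C\<close> whenever
  \<open>a \<in> C\<close> and both \<open>b\<close> and \<open>a + b\<close> are in the support: a connection to \<open>a\<close> is prolonged by one
  entry (\<open>conn_plus\<close>). These two closure properties imply that the span \<open>J\<close> of the \<open>M\<^sub>a\<close> and the products
  \<open>M\<^sub>a M\<^bsub>-a\<^esub>\<close>, \<open>a \<in> C\<close>, is an ideal for the ordinary product. A non-zero product of \<open>M\<^sub>a\<close> with
  \<open>M\<^sub>h\<close> has degree \<open>a + h\<close>, which is \<open>0\<close> or in \<open>C\<close>; in degree \<open>0\<close> it is a generator. A non-zero product of \<open>M\<^sub>a M\<^bsub>-a\<^esub>\<close> with \<open>M\<^sub>h\<close>,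
  \<open>h \<noteq> 0\<close>, has degree \<open>h\<close>, and \<open>h\<close> must be in \<open>C\<close> because associativity makes it pass through a
  non-zero element of degree \<open>h - a\<close>, or \<open>h + a\<close> for products from the left
  (\<open>generator_mmult_component\<close>, \<open>component_mmult_generator\<close>).

  Finally \<open>\<alpha>\<close> and \<open>\<beta>\<close> map the class onto itself (\<open>conn_image\<close>), so \<open>\<psi>\<close> and \<open>\<phi>\<close> permute the
  generators of \<open>J\<close> degreewise and map \<open>J\<close> onto itself. The directness assertions hold because the
  products have degree \<open>0\<close>, which is not in the support.\<close>

section \<open>Finitely supported matrices\<close>

lemma mmult_sum_left:
  assumes "finite K" and "\<forall>i k. A i k \<noteq> 0 \<longrightarrow> k \<in> K"
  shows "mmult A B = (\<lambda>i j. \<Sum>k\<in>K. A i k * B k j)"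
  unfolding mmult_def
proof (intro ext)
  fix i j
  have "{k. A i k * B k j \<noteq> 0} \<subseteq> K"
  proof (rule subsetI, rule ccontr)
    fix k assume "k \<in> {k. A i k * B k j \<noteq> 0}" "k \<notin> K"
    moreover from this have "A i k = 0"
      using assms(2) by blast
    ultimately show False
      by simp
  qed
  then show "(\<Sum>k. A i k * B k j) = (\<Sum>k\<in>K. A i k * B k j)"
    using assms(1) by (intro Sum_any.expand_superset)
qed

lemma mmult_sum_right:
  assumes "finite K" and "\<forall>k j. B k j \<noteq> 0 \<longrightarrow> k \<in> K"
  shows "mmult A B = (\<lambda>i j. \<Sum>k\<in>K. A i k * B k j)"
  unfolding mmult_def
proof (intro ext)
  fix i j
  have "{k. A i k * B k j \<noteq> 0} \<subseteq> K"
  proof (rule subsetI, rule ccontr)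
    fix k assume "k \<in> {k. A i k * B k j \<noteq> 0}" "k \<notin> K"
    moreover from this have "B k j = 0"
      using assms(2) by blast
    ultimately show False
      by simp
  qed
  then show "(\<Sum>k. A i k * B k j) = (\<Sum>k\<in>K. A i k * B k j)"
    using assms(1) by (intro Sum_any.expand_superset)
qed

lemma fin_matrices_columns:
  assumes "A \<in> fin_matrices I"
  obtains K where "finite K" and "\<forall>i k. A i k \<noteq> 0 \<longrightarrow> k \<in> K"
proof
  show "finite (snd ` {(i, j). A i j \<noteq> 0})"
    using assms by (simp add: fin_matrices_def)
qed force

lemma fin_matrices_rows:
  assumes "A \<in> fin_matrices I"
  obtains K where "finite K" and "\<forall>k j. A k j \<noteq> 0 \<longrightarrow> k \<in> K"
proof
  show "finite (fst ` {(i, j). A i j \<noteq> 0})"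
    using assms by (simp add: fin_matrices_def)
qed force

lemma mmult_add_right:
  assumes "A \<in> fin_matrices I"
  shows "mmult A (B + C) = mmult A B + mmult A C"
proof -
  obtain K where "finite K" "\<forall>i k. A i k \<noteq> 0 \<longrightarrow> k \<in> K"
    using fin_matrices_columns[OF assms] by metis
  note * = mmult_sum_left[OF this]
  show ?thesis
    unfolding * by (auto simp: fun_eq_iff distrib_left sum.distrib)
qed

lemma mmult_add_left:
  assumes "C \<in> fin_matrices I"
  shows "mmult (A + B) C = mmult A C + mmult B C"
proof -
  obtain K where "finite K" "\<forall>k j. C k j \<noteq> 0 \<longrightarrow> k \<in> K"
    using fin_matrices_rows[OF assms] by metis
  note * = mmult_sum_right[OF this]
  show ?thesis
    unfolding * by (auto simp: fun_eq_iff distrib_right sum.distrib)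
qed

lemma mmult_mscale_right:
  assumes "A \<in> fin_matrices I"
  shows "mmult A (mscale r B) = mscale r (mmult A B)"
proof -
  obtain K where "finite K" "\<forall>i k. A i k \<noteq> 0 \<longrightarrow> k \<in> K"
    using fin_matrices_columns[OF assms] by metis
  note * = mmult_sum_left[OF this]
  show ?thesis
    unfolding * by (auto simp: fun_eq_iff mscale_def sum_distrib_left algebra_simps)
qed

lemma mmult_mscale_left:
  assumes "B \<in> fin_matrices I"
  shows "mmult (mscale r A) B = mscale r (mmult A B)"
proof -
  obtain K where "finite K" "\<forall>k j. B k j \<noteq> 0 \<longrightarrow> k \<in> K"
    using fin_matrices_rows[OF assms] by metis
  note * = mmult_sum_right[OF this]
  show ?thesis
    unfolding * by (auto simp: fun_eq_iff mscale_def sum_distrib_left algebra_simps)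
qed

lemma mmult_0_left [simp]: "mmult 0 A = 0"
  by (auto simp: mmult_def fun_eq_iff)

lemma mmult_0_right [simp]: "mmult A 0 = 0"
  by (auto simp: mmult_def fun_eq_iff)

lemma mmult_assoc:
  assumes "A \<in> fin_matrices I" and "C \<in> fin_matrices I"
  shows "mmult (mmult A B) C = mmult A (mmult B C)"
proof -
  obtain K where K: "finite K" "\<forall>i k. A i k \<noteq> 0 \<longrightarrow> k \<in> K"
    using fin_matrices_columns[OF assms(1)] by metis
  obtain L where L: "finite L" "\<forall>k j. C k j \<noteq> 0 \<longrightarrow> k \<in> L"
    using fin_matrices_rows[OF assms(2)] by metis
  have "(\<Sum>l\<in>L. (\<Sum>k\<in>K. A i k * B k l) * C l j) = (\<Sum>k\<in>K. A i k * (\<Sum>l\<in>L. B k l * C l j))"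
    for i j
    unfolding sum_distrib_left sum_distrib_right
    by (subst sum.swap) (simp add: mult.assoc)
  then show ?thesis
    unfolding mmult_sum_left[OF K] mmult_sum_right[OF L] by auto
qed

text \<open>From here on matrices are elements of a module. The pointwise rules would rewrite zero and sums
  to \<open>\<lambda>\<close>-abstractions to which the module laws no longer apply.\<close>

declare zero_fun_apply [simp del] plus_fun_apply [simp del]

lemma span_mmult_closed:
  assumes x: "x \<in> imat.span X" and y: "y \<in> imat.span Y"
    and XF: "imat.span X \<subseteq> fin_matrices I" and YF: "imat.span Y \<subseteq> fin_matrices I"
    and J: "imat.subspace J"
    and XY: "\<And>u v. u \<in> X \<Longrightarrow> v \<in> Y \<Longrightarrow> mmult u v \<in> J"
  shows "mmult x y \<in> J"
proof -
  have *: "mmult u y \<in> J" if u: "u \<in> X" for u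
  proof -
    have uF: "u \<in> fin_matrices I"
      using u XF imat.span_base by blast
    have "imat.subspace {y. mmult u y \<in> J}"
      using J by (auto simp: imat.subspace_def mmult_add_right[OF uF] mmult_mscale_right[OF uF])
    moreover have "Y \<subseteq> {y. mmult u y \<in> J}"
      using XY u by blast
    ultimately show ?thesis
      using y imat.span_minimal by blast
  qed
  have yF: "y \<in> fin_matrices I"
    using y YF by blast
  have "imat.subspace {x. mmult x y \<in> J}"
    using J by (auto simp: imat.subspace_def mmult_add_left[OF yF] mmult_mscale_left[OF yF])
  then show ?thesis
    using * x imat.span_minimal[of X "{x. mmult x y \<in> J}"] by blast
qed

lemma span_UN_span:
  "imat.span (\<Union>a\<in>C. imat.span (X a)) = imat.span (\<Union>a\<in>C. X a)"
proof
  have "imat.span (X a) \<subseteq> imat.span (\<Union>a\<in>C. X a)" if "a \<in> C" for a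
    using that by (intro imat.span_mono) blast
  then show "imat.span (\<Union>a\<in>C. imat.span (X a)) \<subseteq> imat.span (\<Union>a\<in>C. X a)"
    by (intro imat.span_minimal imat.subspace_span) blast
  show "imat.span (\<Union>a\<in>C. X a) \<subseteq> imat.span (\<Union>a\<in>C. imat.span (X a))"
    using imat.span_superset by (intro imat.span_mono UN_mono) auto
qed

lemma automorphism_zero:
  assumes "algebra_automorphism I f"
  shows "f 0 = 0"
proof -
  have "0 \<in> fin_matrices I"
    by (simp add: fin_matrices_def zero_fun_def)
  then have "f (mscale 0 0) = mscale 0 (f 0)"
    using assms unfolding algebra_automorphism_def by blast
  then show ?thesis by simp
qed

text \<open>As \<open>f\<close> is linear only on the finitely supported matrices, every linear combination formed here
  is kept inside the span of \<open>X\<close>.\<close>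

lemma automorphism_image_span:
  assumes f: "algebra_automorphism I f" and X: "imat.span X \<subseteq> fin_matrices I"
  shows "f ` imat.span X = imat.span (f ` X)"
proof
  have add: "f (x + y) = f x + f y" and scale: "f (mscale r x) = mscale r (f x)"
    if "x \<in> imat.span X" "y \<in> imat.span X" for x y r
    using f X that unfolding algebra_automorphism_def by blast+
  have f0: "f 0 = 0"
    by (rule automorphism_zero[OF f])
  have "x \<in> imat.span X \<and> f x \<in> imat.span (f ` X)" if "x \<in> imat.span X" for x
    using that
  proof (induction rule: imat.span_induct_alt)
    case base
    show ?case by (simp add: f0 imat.span_zero)
  next
    case (step c x y)
    have "mscale c x \<in> imat.span X"
      using step by (simp add: imat.span_base imat.span_scale)
    moreover have "f (mscale c x) \<in> imat.span (f ` X)"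
      using step by (simp add: scale[of x x] imat.span_base imat.span_scale)
    ultimately show ?case
      using step by (simp add: add imat.span_add)
  qed
  then show "f ` imat.span X \<subseteq> imat.span (f ` X)"
    by blast
  have "imat.subspace (f ` imat.span X)"
    unfolding imat.subspace_def
  proof (intro conjI ballI allI)
    show "0 \<in> f ` imat.span X"
      using f0 imat.span_zero by (metis imageI)
  next
    fix u v assume "u \<in> f ` imat.span X" "v \<in> f ` imat.span X"
    then obtain x y where "u = f x" "v = f y" and xy: "x \<in> imat.span X" "y \<in> imat.span X"
      by blast
    then have "u + v = f (x + y)"
      by (simp add: add)
    then show "u + v \<in> f ` imat.span X"
      using imat.span_add[OF xy] by (rule image_eqI)
  next
    fix r u assume "u \<in> f ` imat.span X"
    then obtain x where "u = f x" and x: "x \<in> imat.span X"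
      by blast
    then have "mscale r u = f (mscale r x)"
      by (simp add: scale[OF x x])
    then show "mscale r u \<in> f ` imat.span X"
      using imat.span_scale[OF x] by (rule image_eqI)
  qed
  then show "imat.span (f ` X) \<subseteq> f ` imat.span X"
    by (intro imat.span_minimal) (auto intro: imat.span_base)
qed

section \<open>Homogeneous components\<close>

definition decomposes ::
    "('g \<Rightarrow> ('i, 'r::comm_ring_1) imatrix set) \<Rightarrow> ('i, 'r) imatrix \<Rightarrow> ('g \<Rightarrow> ('i, 'r) imatrix) \<Rightarrow> bool"
  where "decomposes V x c \<longleftrightarrow> (\<forall>g. c g \<in> V g) \<and> finite {g. c g \<noteq> 0} \<and> x = (\<Sum>g. c g)"

lemma decomposes_single:
  assumes "\<And>g. imat.subspace (V g)" and "x \<in> V h"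
  shows "decomposes V x (\<lambda>g. if g = h then x else 0)"
proof -
  have "(\<Sum>g. if g = h then x else 0) = x"
    by (subst Sum_any.expand_superset[of "{h}"]) auto
  then show ?thesis
    using assms by (auto simp: decomposes_def imat.subspace_0)
qed

lemma decomposes_add:
  assumes "\<And>g. imat.subspace (V g)" and "decomposes V x c" and "decomposes V y d"
  shows "decomposes V (x + y) (\<lambda>g. c g + d g)"
proof -
  have fin: "finite {g. c g \<noteq> 0}" "finite {g. d g \<noteq> 0}"
    using assms by (auto simp: decomposes_def)
  have "{g. c g + d g \<noteq> 0} \<subseteq> {g. c g \<noteq> 0} \<union> {g. d g \<noteq> 0}"
    by auto
  then have "finite {g. c g + d g \<noteq> 0}"
    using fin by (meson finite_UnI finite_subset)
  then show ?thesis
    using assms Sum_any.distrib[OF fin] by (simp add: decomposes_def imat.subspace_add)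
qed

lemma decomposes_mscale:
  assumes "\<And>g. imat.subspace (V g)" and "decomposes V x c"
  shows "decomposes V (mscale r x) (\<lambda>g. mscale r (c g))"
proof -
  have fin: "finite {g. c g \<noteq> 0}" and x: "x = (\<Sum>g | c g \<noteq> 0. c g)"
    using assms by (auto simp: decomposes_def Sum_any.expand_set)
  have sub: "{g. mscale r (c g) \<noteq> 0} \<subseteq> {g. c g \<noteq> 0}"
    by auto
  have "mscale r x = (\<Sum>g. mscale r (c g))"
    unfolding x Sum_any.expand_superset[OF fin sub] by (rule imat.scale_sum_right)
  moreover have "mscale r (c g) \<in> V g" for g
    using assms by (simp add: decomposes_def imat.subspace_scale)
  ultimately show ?thesis
    using finite_subset[OF sub fin] unfolding decomposes_def by blast
qed

lemma mem_span_UN_iff: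
  assumes sub: "\<And>g. imat.subspace (V g)"
  shows "x \<in> imat.span (\<Union>g\<in>C. V g) \<longleftrightarrow> (\<exists>c. decomposes V x c \<and> (\<forall>g. g \<notin> C \<longrightarrow> c g = 0))"
    (is "_ \<longleftrightarrow> ?P x")
proof
  have "imat.subspace {x. ?P x}"
    unfolding imat.subspace_def mem_Collect_eq
  proof (intro conjI ballI allI)
    show "?P 0"
      using sub by (intro exI[of _ "\<lambda>_. 0"]) (auto simp: decomposes_def imat.subspace_0)
  next
    fix x y assume "x \<in> {x. ?P x}" "y \<in> {x. ?P x}"
    then obtain c d where "decomposes V x c" "\<forall>g. g \<notin> C \<longrightarrow> c g = 0"
        "decomposes V y d" "\<forall>g. g \<notin> C \<longrightarrow> d g = 0"
      by auto
    then show "?P (x + y)"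
      using decomposes_add[where V=V, OF sub] by (intro exI[of _ "\<lambda>g. c g + d g"]) auto
  next
    fix r x assume "x \<in> {x. ?P x}"
    then obtain c where "decomposes V x c" "\<forall>g. g \<notin> C \<longrightarrow> c g = 0"
      by auto
    then show "?P (mscale r x)"
      using decomposes_mscale[where V=V, OF sub] by (intro exI[of _ "\<lambda>g. mscale r (c g)"]) auto
  qed
  moreover have "(\<Union>g\<in>C. V g) \<subseteq> {x. ?P x}"
  proof clarify
    fix x h assume h: "h \<in> C" and x: "x \<in> V h"
    then show "?P x"
      using decomposes_single[where V=V, OF sub x] by (intro exI[of _ "\<lambda>g. if g = h then x else 0"]) auto
  qed
  moreover assume "x \<in> imat.span (\<Union>g\<in>C. V g)"
  ultimately show "?P x"
    using imat.span_minimal by blast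
next
  assume "?P x"
  then obtain c where c: "decomposes V x c" "\<forall>g. g \<notin> C \<longrightarrow> c g = 0"
    by blast
  have "(\<Sum>g | c g \<noteq> 0. c g) \<in> imat.span (\<Union>g\<in>C. V g)"
    using c by (intro imat.span_sum imat.span_base) (auto simp: decomposes_def)
  then show "x \<in> imat.span (\<Union>g\<in>C. V g)"
    using c by (auto simp: decomposes_def Sum_any.expand_set)
qed

section \<open>Saturated sets of degrees\<close>

definition inverse_products ::
    "('g::ab_group_add \<Rightarrow> ('i, 'r::comm_ring_1) imatrix set) \<Rightarrow> 'g \<Rightarrow> ('i, 'r) imatrix set" where
  "inverse_products M a = {mmult x y | x y. x \<in> M a \<and> y \<in> M (- a)}"

locale graded_module =
  fixes I :: "'i set" and M :: "'g::ab_group_add \<Rightarrow> ('i, 'r::comm_ring_1) imatrix set"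
  assumes direct: "internal_direct_sum UNIV M (fin_matrices I)"
begin

lemma subspace_component: "imat.subspace (M h)"
  and component_subset: "M h \<subseteq> fin_matrices I"
  and subspace_fin_matrices: "imat.subspace (fin_matrices I :: ('i, 'r) imatrix set)"
  using direct by (auto simp: internal_direct_sum_def)

lemma decomposes_ex1: "x \<in> fin_matrices I \<Longrightarrow> \<exists>!c. decomposes M x c"
  using direct by (simp add: internal_direct_sum_def decomposes_def)

lemma decomposes_fin_matrices: "decomposes M x c \<Longrightarrow> x \<in> fin_matrices I"
  unfolding decomposes_def Sum_any.expand_set
  using component_subset subspace_fin_matrices by (auto intro!: imat.subspace_sum)

lemma decomposes_unique: "decomposes M x c \<Longrightarrow> decomposes M x d \<Longrightarrow> c = d"
  using decomposes_ex1 decomposes_fin_matrices by blast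

lemma fin_matrices_eq_span: "fin_matrices I = imat.span (\<Union>h. M h)"
  using mem_span_UN_iff[where V=M, OF subspace_component, where C=UNIV] decomposes_ex1 decomposes_fin_matrices
  by blast

lemma span_subset_fin_matrices:
  fixes X :: "('i, 'r) imatrix set"
  shows "X \<subseteq> fin_matrices I \<Longrightarrow> imat.span X \<subseteq> fin_matrices I"
  using subspace_fin_matrices by (simp add: imat.span_minimal)

lemma zero_in_component [simp]: "0 \<in> M h"
  by (rule imat.subspace_0[OF subspace_component])

lemma supportI: "x \<in> M h \<Longrightarrow> x \<noteq> 0 \<Longrightarrow> h \<noteq> 0 \<Longrightarrow> h \<in> support M"
  by (auto simp: support_def)

text \<open>Surjectivity of \<open>f\<close> turns the inclusion into an equality: the components of a preimage
  of an element of degree \<open>a h\<close> have images in pairwise different degrees, and so all of them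
  vanish except the one in degree \<open>h\<close>.\<close>

lemma automorphism_image_component:
  assumes f: "algebra_automorphism I f" and a: "bij a"
    and fM: "\<And>h. f ` M h \<subseteq> M (a h)"
  shows "f ` M h = M (a h)"
proof
  show "f ` M h \<subseteq> M (a h)" by (rule fM)
  have f0: "f 0 = 0"
    by (rule automorphism_zero[OF f])
  have inj: "inj_on f (fin_matrices I)" and onto: "f ` fin_matrices I = fin_matrices I"
    using f by (auto simp: algebra_automorphism_def bij_betw_def)
  show "M (a h) \<subseteq> f ` M h"
  proof
    fix y assume y: "y \<in> M (a h)"
    then obtain x where x: "x \<in> fin_matrices I" and yx: "y = f x"
      using component_subset onto by blast
    obtain c where c: "decomposes M x c"
      using decomposes_ex1[OF x] by blast
    have cF: "c k \<in> fin_matrices I" for k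
      using c component_subset by (auto simp: decomposes_def)
    have f_sum: "f (\<Sum>k\<in>K. c k) = (\<Sum>k\<in>K. f (c k))" if "finite K" for K
      using that
    proof induction
      case (insert k K)
      have "(\<Sum>k\<in>K. c k) \<in> fin_matrices I"
        using cF subspace_fin_matrices by (intro imat.subspace_sum)
      then have "f (c k + (\<Sum>k\<in>K. c k)) = f (c k) + f (\<Sum>k\<in>K. c k)"
        using f cF unfolding algebra_automorphism_def by blast
      then show ?case
        using insert by simp
    qed (simp add: f0)
    define d where "d = (\<lambda>k. f (c (inv a k)))"
    have inv_a: "inv a (a k) = k" "a (inv a k) = k" for k
      using a by (simp_all add: bij_is_inj bij_is_surj surj_f_inv_f)
    have dM: "d k \<in> M k" for k
    proof -
      have "f (c (inv a k)) \<in> M (a (inv a k))"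
        using c fM unfolding decomposes_def by blast
      then show ?thesis by (simp add: d_def inv_a)
    qed
    let ?K = "{k. c k \<noteq> 0}"
    have finK: "finite ?K"
      using c by (simp add: decomposes_def)
    have dsub: "{k. d k \<noteq> 0} \<subseteq> a ` ?K"
    proof
      fix k assume "k \<in> {k. d k \<noteq> 0}"
      then have "c (inv a k) \<noteq> 0"
        using f0 by (auto simp: d_def)
      then have "a (inv a k) \<in> a ` ?K"
        by blast
      then show "k \<in> a ` ?K"
        by (simp add: inv_a)
    qed
    have "(\<Sum>k. d k) = (\<Sum>k\<in>a ` ?K. d k)"
      using finK dsub by (intro Sum_any.expand_superset) auto
    also have "\<dots> = (\<Sum>k\<in>?K. f (c k))"
      using a by (subst sum.reindex) (auto simp: d_def inv_a inj_on_def dest: bij_is_inj injD)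
    also have "\<dots> = f x"
      using c f_sum[OF finK] by (simp add: decomposes_def Sum_any.expand_set)
    finally have "decomposes M y d"
      using dM finite_subset[OF dsub] finK by (simp add: decomposes_def yx)
    then have d: "d = (\<lambda>k. if k = a h then y else 0)"
      using decomposes_single[where V=M, OF subspace_component y] decomposes_unique by blast
    then have "f (c h) = y"
      by (metis d_def inv_a(1))
    then show "y \<in> f ` M h"
      using c by (auto simp: decomposes_def)
  qed
qed

lemma automorphism_image_support:
  assumes f: "algebra_automorphism I f" and a: "group_automorphism a"
    and fM: "\<And>h. f ` M h \<subseteq> M (a h)"
  shows "a ` support M = support M"
proof -
  have bij: "bij a" and add: "a (x + y) = a x + a y" for x y
    using a by (auto simp: group_automorphism_def)
  have a0: "a 0 = 0"
    using add[of 0 0] by simp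
  have inj: "inj_on f (fin_matrices I)"
    using f by (auto simp: algebra_automorphism_def bij_betw_def)
  have f0: "f 0 = 0"
    by (rule automorphism_zero[OF f])
  have "M (a h) = {0} \<longleftrightarrow> M h = {0}" for h
  proof -
    have "f ` M h = f ` {0} \<longleftrightarrow> M h = {0}"
      using component_subset by (intro inj_on_image_eq_iff[OF inj]) (use zero_in_component in blast)+
    then show ?thesis
      by (simp add: automorphism_image_component[OF f bij fM] f0)
  qed
  moreover have "a h = 0 \<longleftrightarrow> h = 0" for h
    using bij a0 by (metis bij_is_inj injD)
  ultimately have iff: "a h \<in> support M \<longleftrightarrow> h \<in> support M" for h
    by (simp add: support_def)
  show ?thesis
  proof
    show "a ` support M \<subseteq> support M"
      using iff by blast
    show "support M \<subseteq> a ` support M"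
    proof
      fix k assume "k \<in> support M"
      moreover obtain h where "k = a h"
        using bij by (metis bij_pointE)
      ultimately show "k \<in> a ` support M"
        using iff by blast
    qed
  qed
qed

end

locale graded_matrices = graded_module I M
  for I :: "'i set" and M :: "'g::ab_group_add \<Rightarrow> ('i, 'r::comm_ring_1) imatrix set" +
  assumes mmult_degree: "x \<in> M h \<Longrightarrow> y \<in> M k \<Longrightarrow> mmult x y \<in> M (h + k)"

text \<open>This isolates what the ideal property uses about a class of connected degrees, stated in terms
  of the ordinary product.\<close>

locale saturated_degrees = graded_matrices I M
  for I :: "'i set" and M :: "'g::ab_group_add \<Rightarrow> ('i, 'r::comm_ring_1) imatrix set" +
  fixes C :: "'g set"
  assumes in_support: "C \<subseteq> support M"
    and uminus_closed: "a \<in> C \<Longrightarrow> - a \<in> C"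
    and plus_closed: "a \<in> C \<Longrightarrow> b \<in> support M \<Longrightarrow> a + b \<in> support M \<Longrightarrow> a + b \<in> C"
begin

definition zero_part :: "('i, 'r) imatrix set" where
  "zero_part = imat.span (\<Union>a\<in>C. inverse_products M a)"

definition nonzero_part :: "('i, 'r) imatrix set" where
  "nonzero_part = imat.span (\<Union>a\<in>C. M a)"

definition degree_ideal :: "('i, 'r) imatrix set" where
  "degree_ideal = zero_part + nonzero_part"

lemma zero_notin: "0 \<notin> C"
  using in_support by (auto simp: support_def)

lemma inverse_products_degree: "inverse_products M a \<subseteq> M 0"
  using mmult_degree[of _ a _ "- a"] by (auto simp: inverse_products_def)

lemma zero_part_degree: "zero_part \<subseteq> M 0"
  unfolding zero_part_def using inverse_products_degree subspace_component
  by (intro imat.span_minimal) auto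

lemma degree_ideal_eq_span:
  "degree_ideal = imat.span ((\<Union>a\<in>C. inverse_products M a) \<union> (\<Union>a\<in>C. M a))"
  by (auto simp: degree_ideal_def zero_part_def nonzero_part_def imat.span_Un set_plus_def)

lemma subspace_degree_ideal: "imat.subspace degree_ideal"
  by (simp add: degree_ideal_eq_span)

lemma degree_ideal_subset: "degree_ideal \<subseteq> fin_matrices I"
  unfolding degree_ideal_eq_span
  using inverse_products_degree component_subset by (intro span_subset_fin_matrices) blast

lemma inverse_product_mem: "x \<in> M a \<Longrightarrow> y \<in> M (- a) \<Longrightarrow> a \<in> C \<Longrightarrow> mmult x y \<in> degree_ideal"
  unfolding degree_ideal_eq_span by (rule imat.span_base) (auto simp: inverse_products_def)

lemma component_mem: "x \<in> M a \<Longrightarrow> a \<in> C \<Longrightarrow> x \<in> degree_ideal"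
  unfolding degree_ideal_eq_span by (rule imat.span_base) auto

lemma zero_mem: "0 \<in> degree_ideal"
  by (rule imat.subspace_0[OF subspace_degree_ideal])

lemma nonzero_part_direct: "internal_direct_sum C M nonzero_part"
  unfolding internal_direct_sum_def
proof (intro conjI ballI)
  show "imat.subspace nonzero_part"
    by (simp add: nonzero_part_def)
  show "M a \<subseteq> nonzero_part" if "a \<in> C" for a
    using that unfolding nonzero_part_def by (blast intro: imat.span_base)
  fix x assume "x \<in> nonzero_part"
  then obtain c where c: "decomposes M x c" "\<forall>g. g \<notin> C \<longrightarrow> c g = 0"
    unfolding nonzero_part_def mem_span_UN_iff[where V=M, OF subspace_component] by blast
  show "\<exists>!c. (\<forall>g\<in>C. c g \<in> M g) \<and> (\<forall>g. g \<notin> C \<longrightarrow> c g = 0) \<and> finite {g. c g \<noteq> 0} \<and> x = (\<Sum>g. c g)"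
  proof (intro ex1I[of _ c])
    show "(\<forall>g\<in>C. c g \<in> M g) \<and> (\<forall>g. g \<notin> C \<longrightarrow> c g = 0) \<and> finite {g. c g \<noteq> 0} \<and> x = (\<Sum>g. c g)"
      using c by (simp add: decomposes_def)
  next
    fix d assume d: "(\<forall>g\<in>C. d g \<in> M g) \<and> (\<forall>g. g \<notin> C \<longrightarrow> d g = 0) \<and> finite {g. d g \<noteq> 0} \<and> x = (\<Sum>g. d g)"
    have "d g \<in> M g" for g
      using d by (cases "g \<in> C") auto
    then have "decomposes M x d"
      using d by (simp add: decomposes_def)
    then show "d = c"
      using c decomposes_unique by blast
  qed
qed (rule subspace_component)

lemma zero_part_Int_nonzero_part: "zero_part \<inter> nonzero_part = {0}"
proof
  show "{0} \<subseteq> zero_part \<inter> nonzero_part"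
    by (simp add: zero_part_def nonzero_part_def imat.span_zero)
  show "zero_part \<inter> nonzero_part \<subseteq> {0}"
  proof
    fix x assume x: "x \<in> zero_part \<inter> nonzero_part"
    then have "x \<in> nonzero_part"
      by blast
    then obtain c where c: "decomposes M x c" "\<forall>g. g \<notin> C \<longrightarrow> c g = 0"
      unfolding nonzero_part_def mem_span_UN_iff[where V=M, OF subspace_component] by blast
    have "x \<in> M 0"
      using x zero_part_degree by blast
    then have "c = (\<lambda>g. if g = 0 then x else 0)"
      using decomposes_single[where V=M, OF subspace_component] c(1) decomposes_unique by blast
    then show "x \<in> {0}"
      using c(2) zero_notin by auto
  qed
qed

lemma degree_ideal_graded: "internal_direct_sum UNIV (\<lambda>g. degree_ideal \<inter> M g) degree_ideal"
  unfolding internal_direct_sum_def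
proof (intro conjI ballI)
  show "imat.subspace (degree_ideal \<inter> M g)" for g
    by (intro imat.subspace_inter subspace_degree_ideal subspace_component)
  fix x assume "x \<in> degree_ideal"
  then obtain z v where x: "x = z + v" and z: "z \<in> zero_part" and v: "v \<in> nonzero_part"
    by (auto simp: degree_ideal_def set_plus_def)
  from v obtain c where c: "decomposes M v c" "\<forall>g. g \<notin> C \<longrightarrow> c g = 0"
    unfolding nonzero_part_def mem_span_UN_iff[where V=M, OF subspace_component] by blast
  \<comment> \<open>No clash in degree \<open>0\<close>: as \<open>0\<close> is not in \<open>C\<close>, the component of \<open>v\<close> there vanishes.\<close>
  define d where "d g = (if g = 0 then z else 0) + c g" for g
  have "z \<in> M 0"
    using z zero_part_degree by blast
  then have d: "decomposes M x d"
    unfolding d_def x using c(1)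
    by (intro decomposes_add decomposes_single subspace_component)
  have "z \<in> degree_ideal"
    using z by (simp add: degree_ideal_eq_span zero_part_def imat.span_Un)
      (metis add.right_neutral imat.span_zero)
  moreover have "c g \<in> degree_ideal" for g
    using c component_mem zero_mem by (cases "g \<in> C") (auto simp: decomposes_def)
  ultimately have dJ: "d g \<in> degree_ideal" for g
    unfolding d_def using subspace_degree_ideal zero_mem by (intro imat.subspace_add) auto
  show "\<exists>!c. (\<forall>g\<in>UNIV. c g \<in> degree_ideal \<inter> M g) \<and> (\<forall>g. g \<notin> UNIV \<longrightarrow> c g = 0) \<and>
      finite {g. c g \<noteq> 0} \<and> x = (\<Sum>g. c g)"
  proof (intro ex1I[of _ d])
    show "(\<forall>g\<in>UNIV. d g \<in> degree_ideal \<inter> M g) \<and> (\<forall>g. g \<notin> UNIV \<longrightarrow> d g = 0) \<and>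
        finite {g. d g \<noteq> 0} \<and> x = (\<Sum>g. d g)"
      using d dJ by (simp add: decomposes_def)
  next
    fix e assume "(\<forall>g\<in>UNIV. e g \<in> degree_ideal \<inter> M g) \<and> (\<forall>g. g \<notin> UNIV \<longrightarrow> e g = 0) \<and>
        finite {g. e g \<noteq> 0} \<and> x = (\<Sum>g. e g)"
    then have "decomposes M x e"
      by (simp add: decomposes_def)
    then show "e = d"
      using d decomposes_unique by blast
  qed
qed (auto simp: subspace_degree_ideal)

text \<open>For \<open>u\<close> of degree \<open>a\<close> the closure of \<open>C\<close> under addition applies directly. For \<open>u = x y\<close> with
  \<open>x\<close> and \<open>y\<close> of degrees \<open>a\<close> and \<open>-a\<close> the product has degree \<open>h\<close>, and \<open>h\<close> need not look related
  to \<open>a\<close>. But if \<open>x (y w) \<noteq> 0\<close> and \<open>h \<noteq> 0\<close>, then the degree \<open>h - a\<close> of \<open>y w \<noteq> 0\<close> is \<open>0\<close> or in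
  the support, and \<open>h = a + (h - a)\<close> puts \<open>h\<close> into \<open>C\<close>.\<close>

lemma generator_mmult_component:
  assumes u: "u \<in> (\<Union>a\<in>C. inverse_products M a) \<union> (\<Union>a\<in>C. M a)" and w: "w \<in> M h"
  shows "mmult u w \<in> degree_ideal"
  using u
proof (elim UnE UN_E)
  fix a assume a: "a \<in> C" and u: "u \<in> M a"
  have deg: "mmult u w \<in> M (a + h)"
    by (rule mmult_degree[OF u w])
  consider "mmult u w = 0" | "a + h = 0" | "h = 0" | "a + h \<in> support M" "h \<in> support M"
    using deg w supportI by (metis mmult_0_right)
  then show ?thesis
  proof cases
    case 2
    then have "h = - a" by (simp add: minus_unique)
    then show ?thesis using inverse_product_mem u w a by blast
  qed (use deg a component_mem plus_closed zero_mem in auto)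
next
  fix a assume a: "a \<in> C" and "u \<in> inverse_products M a"
  then obtain x y where u: "u = mmult x y" and x: "x \<in> M a" and y: "y \<in> M (- a)"
    by (auto simp: inverse_products_def)
  have assoc: "mmult u w = mmult x (mmult y w)"
    unfolding u using x w component_subset by (intro mmult_assoc) blast+
  have yw: "mmult y w \<in> M (- a + h)"
    by (rule mmult_degree[OF y w])
  have deg: "mmult u w \<in> M h"
    using mmult_degree[OF x yw] by (simp add: assoc)
  consider "mmult u w = 0" | "h = 0" | "h = a" | "h \<in> support M" "- a + h \<in> support M"
    using deg yw supportI assoc
    by (metis add.inverse_inverse mmult_0_right neg_eq_iff_add_eq_0)
  then show ?thesis
  proof cases
    case 2
    then show ?thesis using inverse_product_mem x yw a by (simp add: assoc)
  next
    case 4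
    then have "a + (- a + h) \<in> C"
      by (intro plus_closed a) (simp_all add: algebra_simps)
    then show ?thesis using deg component_mem by (simp add: algebra_simps)
  qed (use deg a component_mem zero_mem in auto)
qed

text \<open>On the other side the partial product is \<open>w x\<close> of degree \<open>h + a\<close>, so that now
  \<open>h = -a + (h + a)\<close> is used, which starts from \<open>-a \<in> C\<close>.\<close>

lemma component_mmult_generator:
  assumes u: "u \<in> (\<Union>a\<in>C. inverse_products M a) \<union> (\<Union>a\<in>C. M a)" and w: "w \<in> M h"
  shows "mmult w u \<in> degree_ideal"
  using u
proof (elim UnE UN_E)
  fix a assume a: "a \<in> C" and u: "u \<in> M a"
  have deg: "mmult w u \<in> M (a + h)"
    using mmult_degree[OF w u] by (simp add: add.commute)
  consider "mmult w u = 0" | "a + h = 0" | "h = 0" | "a + h \<in> support M" "h \<in> support M"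
    using deg w supportI by (metis mmult_0_left)
  then show ?thesis
  proof cases
    case 2
    then have "h = - a" by (simp add: minus_unique)
    then show ?thesis using inverse_product_mem[of w "- a" u] u w uminus_closed[OF a] by simp
  qed (use deg a component_mem plus_closed zero_mem in auto)
next
  fix a assume a: "a \<in> C" and "u \<in> inverse_products M a"
  then obtain x y where u: "u = mmult x y" and x: "x \<in> M a" and y: "y \<in> M (- a)"
    by (auto simp: inverse_products_def)
  have assoc: "mmult w u = mmult (mmult w x) y"
    unfolding u using y w component_subset by (intro mmult_assoc[symmetric]) blast+
  have wx: "mmult w x \<in> M (h + a)"
    by (rule mmult_degree[OF w x])
  have deg: "mmult w u \<in> M h"
    using mmult_degree[OF wx y] by (simp add: assoc)
  consider "mmult w u = 0" | "h = 0" | "h = - a" | "h \<in> support M" "h + a \<in> support M"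
    using deg wx supportI assoc
    by (metis mmult_0_left add_eq_0_iff2)
  then show ?thesis
  proof cases
    case 2
    then show ?thesis using inverse_product_mem y wx a by (simp add: assoc)
  next
    case 4
    then have "- a + (h + a) \<in> C"
      by (intro plus_closed uminus_closed a) simp_all
    then show ?thesis using deg component_mem by simp
  qed (use deg uminus_closed[OF a] component_mem zero_mem in auto)
qed

lemma degree_ideal_mmult:
  assumes "x \<in> degree_ideal" and "y \<in> fin_matrices I"
  shows "mmult x y \<in> degree_ideal" and "mmult y x \<in> degree_ideal"
proof -
  note span = degree_ideal_eq_span[symmetric] fin_matrices_eq_span[symmetric]
  have *: "x \<in> imat.span ((\<Union>a\<in>C. inverse_products M a) \<union> (\<Union>a\<in>C. M a))"
      "y \<in> imat.span (\<Union>h. M h)"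
    using assms by (simp_all add: span)
  show "mmult x y \<in> degree_ideal"
    by (rule span_mmult_closed[OF *, where I=I])
      (use degree_ideal_subset in \<open>auto simp: span subspace_degree_ideal simp del: Un_iff UN_iff
        intro: generator_mmult_component\<close>)
  show "mmult y x \<in> degree_ideal"
    by (rule span_mmult_closed[OF *(2,1), where I=I])
      (use degree_ideal_subset in \<open>auto simp: span subspace_degree_ideal simp del: Un_iff UN_iff
        intro: component_mmult_generator\<close>)
qed

lemma automorphism_image_degree_ideal:
  assumes f: "algebra_automorphism I f" and a: "group_automorphism a"
    and fM: "\<And>h. f ` M h \<subseteq> M (a h)" and aC: "a ` C = C"
  shows "f ` degree_ideal = degree_ideal"
proof -
  have bij: "bij a" and add: "a (h + k) = a h + a k" for h k
    using a by (auto simp: group_automorphism_def)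
  have minus: "a (- h) = - a h" for h
    using add[of 0 0] add[of h "- h"] by (simp add: eq_neg_iff_add_eq_0 add.commute)
  note comp = automorphism_image_component[OF f bij fM]
  have "f ` inverse_products M h = inverse_products M (a h)" for h
  proof -
    have mult: "f (mmult x y) = mmult (f x) (f y)" if "x \<in> M h" "y \<in> M (- h)" for x y
      using f that component_subset unfolding algebra_automorphism_def by blast
    have "f ` inverse_products M h = {mmult (f x) (f y) | x y. x \<in> M h \<and> y \<in> M (- h)}"
    proof (intro equalityI subsetI)
      fix z assume "z \<in> f ` inverse_products M h"
      then show "z \<in> {mmult (f x) (f y) | x y. x \<in> M h \<and> y \<in> M (- h)}"
        unfolding inverse_products_def using mult by blast
    next
      fix z assume "z \<in> {mmult (f x) (f y) | x y. x \<in> M h \<and> y \<in> M (- h)}"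
      then obtain x y where xy: "z = mmult (f x) (f y)" "x \<in> M h" "y \<in> M (- h)"
        by blast
      then have "z = f (mmult x y)" "mmult x y \<in> inverse_products M h"
        using mult unfolding inverse_products_def by auto
      then show "z \<in> f ` inverse_products M h"
        by blast
    qed
    also have "\<dots> = {mmult x y | x y. x \<in> f ` M h \<and> y \<in> f ` M (- h)}"
      by auto
    also have "\<dots> = inverse_products M (a h)"
      by (simp add: comp minus inverse_products_def)
    finally show ?thesis .
  qed
  then have "f ` ((\<Union>h\<in>C. inverse_products M h) \<union> (\<Union>h\<in>C. M h))
      = (\<Union>h\<in>a ` C. inverse_products M h) \<union> (\<Union>h\<in>a ` C. M h)"
    by (simp add: image_Un image_UN comp)
  then show ?thesis
    unfolding degree_ideal_eq_span aC
    using automorphism_image_span[OF f degree_ideal_subset[unfolded degree_ideal_eq_span]] by simp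
qed

end

section \<open>Connections\<close>

text \<open>For a sequence of length one the final partial sum is its only entry, which puts both clauses
  of the definition into a single form.\<close>

lemma is_connection_iff:
  "is_connection \<alpha> \<beta> S g h gs \<longleftrightarrow>
     gs \<noteq> [] \<and> set gs \<subseteq> S \<and> gs ! 0 \<in> orbit2 \<alpha> \<beta> g \<and>
     (\<forall>l. 2 \<le> l \<and> l < length gs \<longrightarrow> conn_sum \<alpha> \<beta> gs l \<in> S) \<and>
     conn_sum \<alpha> \<beta> gs (length gs) \<in> signed_orbit2 \<alpha> \<beta> h"
proof (cases "length gs" rule: nat.exhaust[case_names zero Suc])
  case (Suc n)
  then show ?thesis
  proof (cases n)
    case 0
    then have "conn_sum \<alpha> \<beta> gs (length gs) = gs ! 0"
      using Suc by (simp add: conn_sum_def)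
    then show ?thesis
      using Suc 0 by (auto simp: is_connection_def)
  next
    case (Suc m)
    with \<open>length gs = Suc n\<close> show ?thesis
      by (auto simp: is_connection_def less_Suc_eq_le)
  qed
qed (simp add: is_connection_def)

lemma conn_sum_snoc:
  assumes "\<And>x y. \<alpha> (x + y) = \<alpha> x + \<alpha> y" and "gs \<noteq> []"
  shows "conn_sum \<alpha> \<beta> (gs @ [b]) (Suc (length gs)) = \<alpha> (conn_sum \<alpha> \<beta> gs (length gs)) + \<beta> b"
proof -
  have a0: "\<alpha> 0 = 0"
    using assms(1)[of 0 0] by simp
  have a_sum: "\<alpha> (\<Sum>t\<in>T. f t) = (\<Sum>t\<in>T. \<alpha> (f t))" for f :: "nat \<Rightarrow> 'a" and T
    by (induction T rule: infinite_finite_induct) (simp_all add: a0 assms(1))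
  obtain n where n: "length gs = Suc n"
    using assms(2) by (cases gs) auto
  have "{2..Suc (length gs)} = insert (Suc (length gs)) {2..length gs}"
    using n by auto
  then have "(\<Sum>t = 2..Suc (length gs). (\<alpha> ^^ (Suc (length gs) - t)) (\<beta> ((gs @ [b]) ! (t - 1))))
      = \<beta> b + (\<Sum>t = 2..length gs. (\<alpha> ^^ (Suc (length gs) - t)) (\<beta> ((gs @ [b]) ! (t - 1))))"
    by simp
  also have "(\<Sum>t = 2..length gs. (\<alpha> ^^ (Suc (length gs) - t)) (\<beta> ((gs @ [b]) ! (t - 1))))
      = (\<Sum>t = 2..length gs. \<alpha> ((\<alpha> ^^ (length gs - t)) (\<beta> (gs ! (t - 1)))))"
    by (intro sum.cong) (auto simp: nth_append Suc_diff_le)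
  finally show ?thesis
    using n by (simp add: conn_sum_def assms(1) a_sum a0 nth_append add_ac del: sum.cl_ivl_Suc)
qed

lemma conn_sum_append:
  assumes "1 \<le> l" and "l \<le> length gs"
  shows "conn_sum \<alpha> \<beta> (gs @ hs) l = conn_sum \<alpha> \<beta> gs l"
  using assms unfolding conn_sum_def
  by (intro arg_cong2[where f="(+)"] sum.cong) (auto simp: nth_append)

lemma conn_sum_map:
  assumes add: "\<And>x y. f (x + y) = f x + f y"
    and comm: "\<And>x. \<alpha> (f x) = f (\<alpha> x)" "\<And>x. \<beta> (f x) = f (\<beta> x)"
    and l: "1 \<le> l" "l \<le> length gs"
  shows "conn_sum \<alpha> \<beta> (map f gs) l = f (conn_sum \<alpha> \<beta> gs l)"
proof -
  have f0: "f 0 = 0"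
    using add[of 0 0] by simp
  have f_sum: "f (\<Sum>t\<in>T. u t) = (\<Sum>t\<in>T. f (u t))" for u :: "nat \<Rightarrow> 'a" and T
    by (induction T rule: infinite_finite_induct) (simp_all add: f0 add)
  have pow: "(\<alpha> ^^ n) (f x) = f ((\<alpha> ^^ n) x)" for n x
    by (induction n) (simp_all add: comm)
  have "map f gs ! 0 = f (gs ! 0)"
    using l by (intro nth_map) auto
  moreover have "(\<Sum>t = 2..l. (\<alpha> ^^ (l - t)) (\<beta> (map f gs ! (t - 1))))
      = (\<Sum>t = 2..l. f ((\<alpha> ^^ (l - t)) (\<beta> (gs ! (t - 1)))))"
    using l by (intro sum.cong) (auto simp: comm pow)
  ultimately show ?thesis
    unfolding conn_sum_def by (simp add: pow add f_sum)
qed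

locale connection_degrees =
  fixes \<alpha> \<beta> :: "'g::ab_group_add \<Rightarrow> 'g" and S :: "'g set" and g :: 'g
  assumes auto: "group_automorphism \<alpha>" "group_automorphism \<beta>"
    and commute: "\<alpha> (\<beta> x) = \<beta> (\<alpha> x)"
    and stable: "\<alpha> ` S = S" "\<beta> ` S = S"
    and symmetric: "h \<in> S \<Longrightarrow> - h \<in> S"
    and start: "g \<in> S"
begin

lemma add: "\<alpha> (x + y) = \<alpha> x + \<alpha> y" "\<beta> (x + y) = \<beta> x + \<beta> y"
  using auto by (auto simp: group_automorphism_def)

lemma minus: "\<alpha> (- x) = - \<alpha> x" "\<beta> (- x) = - \<beta> x"
proof -
  have "\<alpha> 0 = 0" "\<beta> 0 = 0"
    using add(1)[of 0 0] add(2)[of 0 0] by simp_all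
  then show "\<alpha> (- x) = - \<alpha> x" "\<beta> (- x) = - \<beta> x"
    using add(1)[of x "- x"] add(2)[of x "- x"] by (simp_all add: eq_neg_iff_add_eq_0 add.commute)
qed

lemma pow_commute: "(\<alpha> ^^ m) (\<beta> x) = \<beta> ((\<alpha> ^^ m) x)" "(\<beta> ^^ m) (\<alpha> x) = \<alpha> ((\<beta> ^^ m) x)"
  by (induction m) (simp_all add: commute)

lemma pow_add: "(\<alpha> ^^ m) ((\<beta> ^^ n) (x + y)) = (\<alpha> ^^ m) ((\<beta> ^^ n) x) + (\<alpha> ^^ m) ((\<beta> ^^ n) y)"
proof -
  have "(\<beta> ^^ n) (x + y) = (\<beta> ^^ n) x + (\<beta> ^^ n) y" for x y
    by (induction n) (simp_all add: add)
  moreover have "(\<alpha> ^^ m) (x + y) = (\<alpha> ^^ m) x + (\<alpha> ^^ m) y" for x y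
    by (induction m) (simp_all add: add)
  ultimately show ?thesis by simp
qed

lemma pow_minus: "(\<alpha> ^^ m) ((\<beta> ^^ n) (- x)) = - (\<alpha> ^^ m) ((\<beta> ^^ n) x)"
proof -
  have "(\<beta> ^^ n) (- x) = - (\<beta> ^^ n) x" for x
    by (induction n) (simp_all add: minus)
  moreover have "(\<alpha> ^^ m) (- x) = - (\<alpha> ^^ m) x" for x
    by (induction m) (simp_all add: minus)
  ultimately show ?thesis by simp
qed

lemma pow_stable: "x \<in> S \<Longrightarrow> (\<alpha> ^^ m) ((\<beta> ^^ n) x) \<in> S"
proof -
  have "(\<beta> ^^ n) x \<in> S" if "x \<in> S" for x
    using that stable by (induction n) auto
  moreover have "(\<alpha> ^^ m) x \<in> S" if "x \<in> S" for x
    using that stable by (induction m) auto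
  ultimately show "x \<in> S \<Longrightarrow> (\<alpha> ^^ m) ((\<beta> ^^ n) x) \<in> S" by simp
qed

lemma orbit2_stable: "x \<in> orbit2 \<alpha> \<beta> h \<Longrightarrow> \<alpha> x \<in> orbit2 \<alpha> \<beta> h"
  "x \<in> orbit2 \<alpha> \<beta> h \<Longrightarrow> \<beta> x \<in> orbit2 \<alpha> \<beta> h"
proof -
  assume "x \<in> orbit2 \<alpha> \<beta> h"
  then obtain m n where x: "x = (\<alpha> ^^ m) ((\<beta> ^^ n) h)"
    by (auto simp: orbit2_def)
  have "\<alpha> x = (\<alpha> ^^ Suc m) ((\<beta> ^^ n) h)" "\<beta> x = (\<alpha> ^^ m) ((\<beta> ^^ Suc n) h)"
    by (simp_all add: x pow_commute)
  then show "\<alpha> x \<in> orbit2 \<alpha> \<beta> h" "\<beta> x \<in> orbit2 \<alpha> \<beta> h"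
    unfolding orbit2_def by blast+
qed

lemma signed_orbit2_iff:
  "x \<in> signed_orbit2 \<alpha> \<beta> h \<longleftrightarrow>
     (\<exists>m n. x = (\<alpha> ^^ m) ((\<beta> ^^ n) h) \<or> x = (\<alpha> ^^ m) ((\<beta> ^^ n) (- h)))"
  unfolding signed_orbit2_def orbit2_def pow_minus by blast

lemma signed_orbit2_uminus: "signed_orbit2 \<alpha> \<beta> (- h) = signed_orbit2 \<alpha> \<beta> h"
  unfolding signed_orbit2_iff set_eq_iff minus_minus by blast

lemma signed_orbit2_image:
  assumes "x \<in> signed_orbit2 \<alpha> \<beta> h"
  shows "\<alpha> x \<in> signed_orbit2 \<alpha> \<beta> (\<alpha> h)" "\<beta> x \<in> signed_orbit2 \<alpha> \<beta> (\<beta> h)"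
proof -
  obtain m n where *: "x = (\<alpha> ^^ m) ((\<beta> ^^ n) h) \<or> x = (\<alpha> ^^ m) ((\<beta> ^^ n) (- h))"
    using assms by (auto simp: signed_orbit2_iff)
  have "\<alpha> ((\<alpha> ^^ m) y) = (\<alpha> ^^ m) (\<alpha> y)" "\<beta> ((\<beta> ^^ n) y) = (\<beta> ^^ n) (\<beta> y)" for y
    by (simp_all add: funpow_swap1)
  then have "\<alpha> ((\<alpha> ^^ m) ((\<beta> ^^ n) y)) = (\<alpha> ^^ m) ((\<beta> ^^ n) (\<alpha> y))"
      "\<beta> ((\<alpha> ^^ m) ((\<beta> ^^ n) y)) = (\<alpha> ^^ m) ((\<beta> ^^ n) (\<beta> y))" for y
    by (simp_all add: pow_commute flip: pow_commute(1))
  with * show "\<alpha> x \<in> signed_orbit2 \<alpha> \<beta> (\<alpha> h)" "\<beta> x \<in> signed_orbit2 \<alpha> \<beta> (\<beta> h)"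
    unfolding signed_orbit2_iff minus[symmetric] by metis+
qed

lemma signed_orbit2_subset:
  "signed_orbit2 \<alpha> \<beta> (\<alpha> h) \<subseteq> signed_orbit2 \<alpha> \<beta> h"
  "signed_orbit2 \<alpha> \<beta> (\<beta> h) \<subseteq> signed_orbit2 \<alpha> \<beta> h"
proof -
  have "(\<alpha> ^^ m) ((\<beta> ^^ n) (\<alpha> y)) = (\<alpha> ^^ Suc m) ((\<beta> ^^ n) y)"
    "(\<alpha> ^^ m) ((\<beta> ^^ n) (\<beta> y)) = (\<alpha> ^^ m) ((\<beta> ^^ Suc n) y)" for m n y
    by (simp_all add: pow_commute funpow_swap1)
  then show "signed_orbit2 \<alpha> \<beta> (\<alpha> h) \<subseteq> signed_orbit2 \<alpha> \<beta> h"
      "signed_orbit2 \<alpha> \<beta> (\<beta> h) \<subseteq> signed_orbit2 \<alpha> \<beta> h"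
    unfolding subset_iff signed_orbit2_iff minus[symmetric] by metis+
qed

lemma signed_orbit2_stable: "h \<in> S \<Longrightarrow> signed_orbit2 \<alpha> \<beta> h \<subseteq> S"
  using pow_stable symmetric unfolding subset_iff signed_orbit2_iff by metis

abbreviation conn :: "'g set" where
  "conn \<equiv> conn_rel \<alpha> \<beta> S `` {g}"

lemma mem_conn: "h \<in> conn \<longleftrightarrow> h \<in> S \<and> (\<exists>gs. is_connection \<alpha> \<beta> S g h gs)"
  using start by (simp add: conn_rel_def)

lemma is_connection_map:
  assumes "is_connection \<alpha> \<beta> S g h gs"
  shows "is_connection \<alpha> \<beta> S g (\<alpha> h) (map \<alpha> gs)" "is_connection \<alpha> \<beta> S g (\<beta> h) (map \<beta> gs)"
proof -
  have gs: "gs \<noteq> []" "set gs \<subseteq> S" "gs ! 0 \<in> orbit2 \<alpha> \<beta> g"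
    "conn_sum \<alpha> \<beta> gs (length gs) \<in> signed_orbit2 \<alpha> \<beta> h"
    "\<And>l. 2 \<le> l \<Longrightarrow> l < length gs \<Longrightarrow> conn_sum \<alpha> \<beta> gs l \<in> S"
    using assms by (auto simp: is_connection_iff)
  have len: "1 \<le> length gs"
    using gs(1) by (cases gs) auto
  have *: "conn_sum \<alpha> \<beta> (map \<alpha> gs) l = \<alpha> (conn_sum \<alpha> \<beta> gs l)"
    "conn_sum \<alpha> \<beta> (map \<beta> gs) l = \<beta> (conn_sum \<alpha> \<beta> gs l)" if "1 \<le> l" "l \<le> length gs" for l
    using that by (simp_all add: conn_sum_map add commute)
  have hd: "map \<alpha> gs ! 0 = \<alpha> (gs ! 0)" "map \<beta> gs ! 0 = \<beta> (gs ! 0)"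
    using gs(1) by auto
  show "is_connection \<alpha> \<beta> S g (\<alpha> h) (map \<alpha> gs)" "is_connection \<alpha> \<beta> S g (\<beta> h) (map \<beta> gs)"
    unfolding is_connection_iff hd length_map
    using gs(1,2) stable orbit2_stable[OF gs(3)] * gs(5) signed_orbit2_image[OF gs(4)] len
    by auto
qed

text \<open>If a connection ends in \<open>\<plusminus>\<alpha>\<^sup>m\<beta>\<^sup>n(h)\<close>, then applying \<open>\<alpha>\<close> to each entry gives one to \<open>\<alpha>(h)\<close>. In the
  converse direction nothing has to be changed: if \<open>h = \<alpha>(k)\<close>, the end is \<open>\<plusminus>\<alpha>\<^sup>m\<^sup>+\<^sup>1\<beta>\<^sup>n(k)\<close>, so that
  the same sequence connects to \<open>k\<close>.\<close>

lemma conn_image: "\<alpha> ` conn = conn" "\<beta> ` conn = conn"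
proof -
  have "\<alpha> h \<in> conn" "\<beta> h \<in> conn" if "h \<in> conn" for h
    using that is_connection_map stable unfolding mem_conn by blast+
  moreover have "h \<in> \<alpha> ` conn" "h \<in> \<beta> ` conn" if h: "h \<in> conn" for h
  proof -
    obtain gs where gs: "is_connection \<alpha> \<beta> S g h gs"
      using h unfolding mem_conn by blast
    obtain k l where k: "k \<in> S" "h = \<alpha> k" and l: "l \<in> S" "h = \<beta> l"
      using h stable unfolding mem_conn by blast
    have "is_connection \<alpha> \<beta> S g k gs" "is_connection \<alpha> \<beta> S g l gs"
      using gs signed_orbit2_subset(1)[of k] signed_orbit2_subset(2)[of l]
      by (auto simp: is_connection_iff simp flip: k(2) l(2))
    then have "k \<in> conn" "l \<in> conn"
      using k(1) l(1) unfolding mem_conn by blast+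
    then show "h \<in> \<alpha> ` conn" "h \<in> \<beta> ` conn"
      using k(2) l(2) by (blast intro: image_eqI)+
  qed
  ultimately show "\<alpha> ` conn = conn" "\<beta> ` conn = conn"
    by blast+
qed

lemma conn_uminus: "h \<in> conn \<Longrightarrow> - h \<in> conn"
  unfolding mem_conn is_connection_iff signed_orbit2_uminus using symmetric by blast

text \<open>A connection to \<open>a\<close> ends in \<open>\<plusminus>\<alpha>\<^sup>m\<beta>\<^sup>n(a)\<close>. Appending the entry
  \<open>\<plusminus>\<beta>\<^sup>-\<^sup>1\<alpha>\<^sup>m\<^sup>+\<^sup>1\<beta>\<^sup>n(b)\<close> gives a sequence that ends in \<open>\<plusminus>\<alpha>\<^sup>m\<^sup>+\<^sup>1\<beta>\<^sup>n(a + b)\<close>;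
  the entry is in \<open>S\<close> because \<open>\<beta>\<close> maps \<open>S\<close> onto itself.\<close>

lemma conn_plus:
  assumes a: "a \<in> conn" and b: "b \<in> S" and ab: "a + b \<in> S"
  shows "a + b \<in> conn"
proof -
  obtain gs where conn: "is_connection \<alpha> \<beta> S g a gs" and aS: "a \<in> S"
    using a unfolding mem_conn by blast
  have gs: "gs \<noteq> []" "set gs \<subseteq> S" "gs ! 0 \<in> orbit2 \<alpha> \<beta> g"
    "conn_sum \<alpha> \<beta> gs (length gs) \<in> signed_orbit2 \<alpha> \<beta> a"
    "\<And>l. 2 \<le> l \<Longrightarrow> l < length gs \<Longrightarrow> conn_sum \<alpha> \<beta> gs l \<in> S"
    using conn by (auto simp: is_connection_iff)
  obtain m n where "conn_sum \<alpha> \<beta> gs (length gs) = (\<alpha> ^^ m) ((\<beta> ^^ n) a)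
      \<or> conn_sum \<alpha> \<beta> gs (length gs) = (\<alpha> ^^ m) ((\<beta> ^^ n) (- a))"
    using gs(4) by (auto simp: signed_orbit2_iff)
  then obtain b' where b': "b' \<in> S"
    and sum: "\<alpha> (conn_sum \<alpha> \<beta> gs (length gs)) + \<beta> b' \<in> signed_orbit2 \<alpha> \<beta> (a + b)"
  proof (elim disjE)
    assume *: "conn_sum \<alpha> \<beta> gs (length gs) = (\<alpha> ^^ m) ((\<beta> ^^ n) a)"
    obtain b' where "b' \<in> S" "\<beta> b' = (\<alpha> ^^ Suc m) ((\<beta> ^^ n) b)"
      using pow_stable[OF b, of "Suc m" n] stable(2) by (metis imageE)
    moreover from this have "\<alpha> (conn_sum \<alpha> \<beta> gs (length gs)) + \<beta> b'
        = (\<alpha> ^^ Suc m) ((\<beta> ^^ n) (a + b))"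
      unfolding pow_add by (simp add: *)
    ultimately show thesis
      using that signed_orbit2_iff by blast
  next
    assume *: "conn_sum \<alpha> \<beta> gs (length gs) = (\<alpha> ^^ m) ((\<beta> ^^ n) (- a))"
    obtain b' where "b' \<in> S" "\<beta> b' = (\<alpha> ^^ Suc m) ((\<beta> ^^ n) (- b))"
      using pow_stable[OF symmetric[OF b], of "Suc m" n] stable(2) by (metis imageE)
    moreover from this have "\<alpha> (conn_sum \<alpha> \<beta> gs (length gs)) + \<beta> b'
        = (\<alpha> ^^ Suc m) ((\<beta> ^^ n) (- (a + b)))"
      unfolding minus_add_distrib pow_add by (simp add: *)
    ultimately show thesis
      using that signed_orbit2_iff by blast
  qed
  have "conn_sum \<alpha> \<beta> (gs @ [b']) l \<in> S" if "2 \<le> l" "l \<le> length gs" for l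
    using that gs(4,5) signed_orbit2_stable[OF aS]
    by (cases "l = length gs") (auto simp: conn_sum_append)
  then have "is_connection \<alpha> \<beta> S g (a + b) (gs @ [b'])"
    unfolding is_connection_iff
    using gs(1-3) b' sum conn_sum_snoc[OF add(1) gs(1)] by (auto simp: nth_append)
  then show ?thesis
    using ab unfolding mem_conn by blast
qed

end

section \<open>The ideal of a class\<close>

theorem theorem4p3:
  fixes I :: "'i set"
    and \<psi> \<phi> :: "('i, 'r::comm_ring_1) imatrix \<Rightarrow> ('i, 'r) imatrix"
    and \<alpha> \<beta> :: "'g::ab_group_add \<Rightarrow> 'g"
    and M :: "'g \<Rightarrow> ('i, 'r) imatrix set"
    and g :: 'g
  assumes "algebra_automorphism I \<psi>" and "algebra_automorphism I \<phi>"
    and "\<forall>A\<in>fin_matrices I. \<psi> (\<phi> A) = \<phi> (\<psi> A)"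
    and "group_automorphism \<alpha>" and "group_automorphism \<beta>"
    and "\<alpha> \<circ> \<beta> = \<beta> \<circ> \<alpha>"
    and "internal_direct_sum UNIV M (fin_matrices I)"
    and "\<forall>h. \<psi> ` M h \<subseteq> M (\<alpha> h)"
    and "\<forall>h. \<phi> ` M h \<subseteq> M (\<beta> h)"
    and "\<forall>h h'. star_set \<psi> \<phi> (M h) (M h') \<subseteq> M (\<alpha> h + \<beta> h')"
    and "\<forall>h\<in>support M. - h \<in> support M"
    and "g \<in> support M"
  shows "internal_direct_sum (conn_class \<alpha> \<beta> M g) M (class_part \<alpha> \<beta> M g)
    \<and> ideal_zero_part \<psi> \<phi> \<alpha> \<beta> M g \<inter> class_part \<alpha> \<beta> M g = {0}
    \<and> graded_ideal I \<psi> \<phi> M (class_ideal \<psi> \<phi> \<alpha> \<beta> M g)"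
proof -
  have \<psi>: "algebra_automorphism I \<psi>" and \<phi>: "algebra_automorphism I \<phi>"
    and \<alpha>: "group_automorphism \<alpha>" and \<beta>: "group_automorphism \<beta>"
    and direct: "internal_direct_sum UNIV M (fin_matrices I)"
    and \<psi>M: "\<psi> ` M h \<subseteq> M (\<alpha> h)" and \<phi>M: "\<phi> ` M h \<subseteq> M (\<beta> h)" for h
    using assms by blast+
  have bij: "bij \<alpha>" "bij \<beta>"
    using \<alpha> \<beta> by (simp_all add: group_automorphism_def)
  have commute: "\<alpha> (\<beta> x) = \<beta> (\<alpha> x)" for x
    using assms(6) by (metis comp_apply)
  have star_degree: "star \<psi> \<phi> x y \<in> M (\<alpha> h + \<beta> k)" if "x \<in> M h" "y \<in> M k" for x y h k
  proof -
    have "star \<psi> \<phi> x y \<in> star_set \<psi> \<phi> (M h) (M k)"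
      unfolding star_set_def using that by (blast intro: imat.span_base)
    then show ?thesis
      using assms(10) by blast
  qed
  interpret graded_module I M
    by unfold_locales (rule direct)
  have images: "\<psi> ` M h = M (\<alpha> h)" "\<phi> ` M h = M (\<beta> h)" for h
    by (rule automorphism_image_component[OF \<psi> bij(1) \<psi>M] automorphism_image_component[OF \<phi> bij(2) \<phi>M])+
  \<comment> \<open>Homogeneous factors are images of homogeneous elements, so \<open>x y = x' \<star> y'\<close> for suitable ones.\<close>
  interpret graded_matrices I M
  proof
    fix x y h k assume x: "x \<in> M h" and y: "y \<in> M k"
    obtain h' k' where hk: "h = \<alpha> h'" "k = \<beta> k'"
      using bij by (metis bij_pointE)
    then obtain x' y' where "x' \<in> M h'" "x = \<psi> x'" "y' \<in> M k'" "y = \<phi> y'"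
      using x y images by blast
    then show "mmult x y \<in> M (h + k)"
      using star_degree[of x' h' y' k'] by (simp add: star_def hk)
  qed
  interpret connection_degrees \<alpha> \<beta> "support M" g
    using assms \<alpha> \<beta> commute automorphism_image_support[OF \<psi> \<alpha> \<psi>M]
      automorphism_image_support[OF \<phi> \<beta> \<phi>M]
    by unfold_locales auto
  have conn: "conn_class \<alpha> \<beta> M g = conn"
    by (simp add: conn_class_def)
  interpret saturated_degrees I M conn
    using conn_uminus conn_plus by unfold_locales (auto simp: conn_rel_def)
  have nonzero: "class_part \<alpha> \<beta> M g = nonzero_part"
    by (simp add: class_part_def nonzero_part_def conn)
  have star_products: "star_set \<psi> \<phi> (M (\<beta> h)) (M (- \<alpha> h)) = imat.span (inverse_products M (\<alpha> (\<beta> h)))"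
    for h
  proof -
    have "{star \<psi> \<phi> x y | x y. x \<in> M (\<beta> h) \<and> y \<in> M (- \<alpha> h)}
        = {mmult x y | x y. x \<in> \<psi> ` M (\<beta> h) \<and> y \<in> \<phi> ` M (- \<alpha> h)}"
      by (auto simp: star_def)
    also have "\<dots> = inverse_products M (\<alpha> (\<beta> h))"
      by (simp add: images minus commute inverse_products_def)
    finally show ?thesis
      by (simp add: star_set_def)
  qed
  \<comment> \<open>The shift by \<open>\<alpha> \<circ> \<beta>\<close> only permutes the summands.\<close>
  have "(\<Union>h\<in>conn. inverse_products M (\<alpha> (\<beta> h))) = (\<Union>h\<in>\<alpha> ` \<beta> ` conn. inverse_products M h)"
    by simp
  then have zero: "ideal_zero_part \<psi> \<phi> \<alpha> \<beta> M g = zero_part"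
    by (simp add: ideal_zero_part_def zero_part_def conn star_products span_UN_span conn_image)
  have ideal: "class_ideal \<psi> \<phi> \<alpha> \<beta> M g = degree_ideal"
    by (simp add: class_ideal_def degree_ideal_def zero nonzero)
  have \<psi>J: "\<psi> ` degree_ideal = degree_ideal"
    by (rule automorphism_image_degree_ideal[OF \<psi> \<alpha> \<psi>M conn_image(1)])
  have \<phi>J: "\<phi> ` degree_ideal = degree_ideal"
    by (rule automorphism_image_degree_ideal[OF \<phi> \<beta> \<phi>M conn_image(2)])
  have F: "\<psi> x \<in> fin_matrices I" "\<phi> x \<in> fin_matrices I" if "x \<in> fin_matrices I" for x
    using \<psi> \<phi> that by (auto simp: algebra_automorphism_def bij_betw_def)
  have "star_set \<psi> \<phi> degree_ideal (fin_matrices I) \<subseteq> degree_ideal"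
    unfolding star_set_def star_def using \<psi>J F degree_ideal_mmult(1) subspace_degree_ideal
    by (intro imat.span_minimal) blast+
  moreover have "star_set \<psi> \<phi> (fin_matrices I) degree_ideal \<subseteq> degree_ideal"
    unfolding star_set_def star_def using \<phi>J F degree_ideal_mmult(2) subspace_degree_ideal
    by (intro imat.span_minimal) blast+
  ultimately have "star_set \<psi> \<phi> degree_ideal (fin_matrices I)
      + star_set \<psi> \<phi> (fin_matrices I) degree_ideal \<subseteq> degree_ideal"
    using subspace_degree_ideal by (auto simp: set_plus_def intro: imat.subspace_add)
  then have "graded_ideal I \<psi> \<phi> M degree_ideal"
    unfolding graded_ideal_def
    using subspace_degree_ideal degree_ideal_subset \<psi>J \<phi>J degree_ideal_graded by blast
  then show ?thesis
    using nonzero_part_direct zero_part_Int_nonzero_part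
    unfolding nonzero zero ideal conn by blast
qed

end
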